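(* For every Boolean function $f:\{0,1\}^n\to\{0,1\}$, $n\ge1$, the following are equivalent: 1. $f\in\mathrm{ST}$; 2. $f\in\mathrm{Pol}(\mathbb{ST}_L,\mathbb{ST}_R)\cap\mathrm{Pol}(\{0\})\cap\mathrm{Pol}(\{1\})$; 3. $f$ is idempotent and every non-unary minor of $f$ has a fixing pair (note that $f$ is its own minor as well).
   Context: For a real tuple $\overline a=(a_1,\dots,a_n)$ and a real $t$, $\langle\overline a|^t_{\le}:\{0,1\}^n\to\{0,1\}$ has value $0$ at $\overline x$ if $\sum_i a_ix_i\le t$ and value $1$ otherwise. A function $g:A^m\to B$ is a minor of $f:A^n\to B$ if for some $\pi:[n]\to[m]$, $g(a_1,\dots,a_m)=f(a_{\pi(1)},\dots,a_{\pi(n)})$ for all $a_1,\dots,a_m\in A$; non-unary means arity at least $2$. A minion is a set of functions closed under minors; the minion generated by a set is the smallest minion containing it. $\mathrm{ST}$ is the minion generated by the functions $\langle 1,2,-2,4,-4,\dots,2^m,-2^m|^{0}_{\le}$ of arity $2m+1$, for all $m\ge0$. $\mathrm{Pol}(\mathbb{A},\mathbb{B})$, for similar relational structures, is the set of all homomorphisms $\mathbb{A}^n\to\mathbb{B}$, $n\ge1$ ($\mathbb{A}^n$ having coordinatewise relations). $\mathrm{Pol}(\{c\})$, $c\in\{0,1\}$, is the set of Boolean functions preserving the unary relation $\{c\}$, i.e. with $f(c,\dots,c)=c$. $\mathbb{ST}_L$ and $\mathbb{ST}_R$ are relational structures on $\{0,1\}$, $\mathbb{ST}_L=(\{0,1\};R,2\mathrm{in}4)$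 and $\mathbb{ST}_R=(\{0,1\};\mathrm{NAE}_6,\mathrm{NAE}_4)$, where $R$ is the $6$-ary relation $$R=\{(1,0,1,0,1,0),(0,1,0,1,0,1),(1,1,0,0,0,0),(0,0,1,1,0,0),(0,0,0,0,1,1)\},$$ $2\mathrm{in}4$ is the set of all $4$-tuples in $\{0,1\}^4$ with exactly two entries equal to $1$, and $\mathrm{NAE}_k$ is the set of all non-constant $k$-tuples in $\{0,1\}^k$. $f$ is idempotent if $f(a,\dots,a)=a$ for $a\in\{0,1\}$. A pair $(i,j)$ of distinct coordinates is a fixing pair of a Boolean function $f$ if $f(\overline a)=0$ whenever $a_i=0$ and $a_j=1$, and $f(\overline a)=1$ whenever $a_i=1$ and $a_j=0$. *)

theory Defs
  imports Complex_Main "HOL-Library.FuncSet" "HOL-Library.NList"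
begin

section \<open>Functions of several variables, minors and minions\<close>

text \<open>
  A function \<open>A\<^sup>n \<rightarrow> B\<close> of positive arity \<open>n\<close> is represented by a pair \<open>(n, f)\<close>, where the
  tuples in \<open>A\<^sup>n\<close> are the lists in \<^term>\<open>nlists n A\<close> and \<open>f\<close> is undefined outside of this set, so
  that equal functions are represented by equal pairs. Coordinates are counted from \<open>0\<close>.
\<close>

type_synonym ('a, 'b) finfun = "nat \<times> ('a list \<Rightarrow> 'b)"

definition finfuns :: "'a set \<Rightarrow> 'b set \<Rightarrow> ('a, 'b) finfun set" where
  "finfuns A B = {(n, f). n \<ge> 1 \<and> f \<in> nlists n A \<rightarrow>\<^sub>E B}"

fun minor_of :: "'a set \<Rightarrow> 'b set \<Rightarrow> ('a, 'b) finfun \<Rightarrow> ('a, 'b) finfun \<Rightarrow> bool" where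
  "minor_of A B (m, g) (n, f) \<longleftrightarrow>
     (m, g) \<in> finfuns A B \<and> (n, f) \<in> finfuns A B \<and>
     (\<exists>\<pi> \<in> {..<n} \<rightarrow> {..<m}. \<forall>a \<in> nlists m A. g a = f (map (\<lambda>i. a ! \<pi> i) [0..<n]))"

definition minion :: "'a set \<Rightarrow> 'b set \<Rightarrow> ('a, 'b) finfun set \<Rightarrow> bool" where
  "minion A B M \<longleftrightarrow> M \<subseteq> finfuns A B \<and> (\<forall>F \<in> M. \<forall>G. minor_of A B G F \<longrightarrow> G \<in> M)"

text \<open>The minion generated by a set \<open>S\<close> of functions is \<^term>\<open>minion A B hull S\<close>.\<close>

lemma minor_of_finfuns:
  assumes "minor_of A B G F"
  shows "G \<in> finfuns A B" and "F \<in> finfuns A B"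
  using assms by (cases F, cases G, simp only: minor_of.simps)+

lemma minionD: "minion A B M \<Longrightarrow> F \<in> M \<Longrightarrow> minor_of A B G F \<Longrightarrow> G \<in> M"
  by (simp only: minion_def)

lemma minionI:
  assumes "M \<subseteq> finfuns A B"
    and "\<And>F G. F \<in> M \<Longrightarrow> minor_of A B G F \<Longrightarrow> G \<in> M"
  shows "minion A B M"
  unfolding minion_def by (intro conjI ballI allI impI) (fact assms)+

lemma minion_finfuns: "minion A B (finfuns A B)"
  by (rule minionI) (auto dest: minor_of_finfuns(1))

lemma minion_hull:
  assumes "S \<subseteq> finfuns A B"
  shows "minion A B (minion A B hull S)"
proof (rule minionI)
  show "minion A B hull S \<subseteq> finfuns A B"
    using assms minion_finfuns by (rule hull_minimal)
next
  fix F G assume F: "F \<in> minion A B hull S" and G: "minor_of A B G F"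
  show "G \<in> minion A B hull S"
    unfolding hull_def
  proof (rule InterI, elim CollectE conjE)
    fix M assume M: "minion A B M" "S \<subseteq> M"
    have "minion A B hull S \<subseteq> M"
      using M(2,1) by (rule hull_minimal)
    then have "F \<in> M"
      using F by (rule subsetD)
    then show "G \<in> M" using M(1) G by (intro minionD[of A B M F G])
  qed
qed


section \<open>Threshold functions and the minion \<open>ST\<close>\<close>

text \<open>The elements \<open>0\<close> and \<open>1\<close> of the domain are \<^const>\<open>False\<close> and \<^const>\<open>True\<close>.\<close>

definition threshold :: "real list \<Rightarrow> real \<Rightarrow> (bool, bool) finfun" where
  "threshold a t =
     (length a,
      \<lambda>x \<in> nlists (length a) UNIV. \<not> ((\<Sum>i<length a. a ! i * of_bool (x ! i)) \<le> t))"

text \<open>The tuple \<open>(1, 2, -2, 4, -4, \<dots>, 2\<^sup>m, -2\<^sup>m)\<close>.\<close>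

definition st_tuple :: "nat \<Rightarrow> real list" where
  "st_tuple m = 1 # concat (map (\<lambda>k. [2 ^ k, - (2 ^ k)]) [1..<Suc m])"

definition ST :: "(bool, bool) finfun set" where
  "ST = minion UNIV UNIV hull {threshold (st_tuple m) 0 | m. True}"

lemma length_st_tuple: "length (st_tuple m) = 2 * m + 1"
  by (induction m) (auto simp: st_tuple_def)

lemma threshold_finfuns: "a \<noteq> [] \<Longrightarrow> threshold a t \<in> finfuns UNIV UNIV"
  by (cases a) (auto simp: threshold_def finfuns_def)

lemma minion_ST: "minion UNIV UNIV ST"
  unfolding ST_def
  by (rule minion_hull) (auto simp: st_tuple_def intro!: threshold_finfuns)


section \<open>Relational structures and polymorphisms\<close>

text \<open>
  The relations of a structure are listed together with their arities.
\<close>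

record 'a rel_structure =
  universe :: "'a set"
  relations :: "(nat \<times> 'a list set) list"

definition rel_structure :: "'a rel_structure \<Rightarrow> bool" where
  "rel_structure \<AA> \<longleftrightarrow> (\<forall>(k, R) \<in> set (relations \<AA>). R \<subseteq> nlists k (universe \<AA>))"

definition similar :: "'a rel_structure \<Rightarrow> 'b rel_structure \<Rightarrow> bool" where
  "similar \<AA> \<BB> \<longleftrightarrow> map fst (relations \<AA>) = map fst (relations \<BB>)"

definition homs :: "'a rel_structure \<Rightarrow> 'b rel_structure \<Rightarrow> ('a \<Rightarrow> 'b) set" where
  "homs \<AA> \<BB> =
     {h \<in> universe \<AA> \<rightarrow>\<^sub>E universe \<BB>.
        similar \<AA> \<BB> \<and>
        (\<forall>k < length (relations \<AA>). \<forall>xs \<in> snd (relations \<AA> ! k). map h xs \<in> snd (relations \<BB> ! k))}"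

text \<open>An element of a relation of \<open>\<AA>\<^sup>n\<close> is a list of elements of \<open>\<AA>\<^sup>n\<close>, i.e. a list of lists.\<close>

definition power_structure :: "'a rel_structure \<Rightarrow> nat \<Rightarrow> 'a list rel_structure" where
  "power_structure \<AA> n =
     \<lparr>universe = nlists n (universe \<AA>),
      relations =
        map (\<lambda>(k, R). (k, {xs \<in> nlists k (nlists n (universe \<AA>)). \<forall>i<n. map (\<lambda>x. x ! i) xs \<in> R}))
          (relations \<AA>)\<rparr>"

definition Pol :: "'a rel_structure \<Rightarrow> 'b rel_structure \<Rightarrow> ('a, 'b) finfun set" where
  "Pol \<AA> \<BB> = {(n, f). n \<ge> 1 \<and> f \<in> homs (power_structure \<AA> n) \<BB>}"

text \<open>The structure \<open>({0,1}; {c})\<close>, so that \<open>Pol({c})\<close> is \<open>Pol (singleton_structure c) (singleton_structure c)\<close>.\<close>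

definition singleton_structure :: "bool \<Rightarrow> bool rel_structure" where
  "singleton_structure c = \<lparr>universe = UNIV, relations = [(1, {[c]})]\<rparr>"

abbreviation Pol_singleton :: "bool \<Rightarrow> (bool, bool) finfun set" where
  "Pol_singleton c \<equiv> Pol (singleton_structure c) (singleton_structure c)"

definition two_in_four :: "bool list set" where
  "two_in_four = {xs \<in> nlists 4 UNIV. count_list xs True = 2}"

definition NAE :: "nat \<Rightarrow> bool list set" where
  "NAE k = {xs \<in> nlists k UNIV. \<not> (\<exists>c. xs = replicate k c)}"

definition ST_rel :: "bool list set" where
  "ST_rel =
     {[True, False, True, False, True, False],
      [False, True, False, True, False, True],
      [True, True, False, False, False, False],
      [False, False, True, True, False, False],
      [False, False, False, False, True, True]}"

definition ST_L :: "bool rel_structure" where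
  "ST_L = \<lparr>universe = UNIV, relations = [(6, ST_rel), (4, two_in_four)]\<rparr>"

definition ST_R :: "bool rel_structure" where
  "ST_R = \<lparr>universe = UNIV, relations = [(6, NAE 6), (4, NAE 4)]\<rparr>"

lemma rel_structure_ST: "rel_structure ST_L" "rel_structure ST_R"
  by (simp_all add: rel_structure_def ST_L_def ST_R_def ST_rel_def two_in_four_def NAE_def
      in_nlists_UNIV subset_iff)

lemma similar_power: "similar (power_structure \<AA> n) \<BB> \<longleftrightarrow> similar \<AA> \<BB>"
proof -
  have "map fst (relations (power_structure \<AA> n)) = map fst (relations \<AA>)"
    by (simp add: power_structure_def comp_def case_prod_unfold)
  then show ?thesis by (simp add: similar_def)
qed

lemma similar_ST: "similar ST_L ST_R"
  by (simp add: similar_def ST_L_def ST_R_def)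

lemma Pol_singleton_iff:
  "(n, f) \<in> Pol_singleton c \<longleftrightarrow> (n, f) \<in> finfuns UNIV UNIV \<and> f (replicate n c) = c"
proof -
  have "xs \<in> nlists 1 (nlists n (UNIV :: bool set)) \<and> (\<forall>i<n. map (\<lambda>x. x ! i) xs \<in> {[c]}) \<longleftrightarrow>
      xs = [replicate n c]" (is "?P xs \<longleftrightarrow> _") for xs
  proof
    assume xs: "?P xs"
    then have "length xs = 1" by (simp add: nlists_def del: nlistsE_length nlistsE_set)
    then obtain x where x: "xs = [x]"
      unfolding One_nat_def length_Suc_conv by blast
    have "length x = n" "\<forall>i<n. x ! i = c"
      using xs unfolding x by (simp_all add: nlists_def del: nlistsE_length nlistsE_set)
    then show "xs = [replicate n c]"
      unfolding x by (simp add: list_eq_iff_nth_eq)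
  next
    assume "xs = [replicate n c]"
    then show "?P xs" by (simp add: nlists_def del: nlistsE_length nlistsE_set)
  qed
  then have "relations (power_structure (singleton_structure c) n) = [(1, {[replicate n c]})]"
    by (simp add: power_structure_def singleton_structure_def)
  moreover have "universe (power_structure (singleton_structure c) n) = nlists n UNIV"
    by (simp add: power_structure_def singleton_structure_def)
  ultimately have "homs (power_structure (singleton_structure c) n) (singleton_structure c) =
      {f \<in> nlists n UNIV \<rightarrow>\<^sub>E UNIV. f (replicate n c) = c}"
    by (simp add: homs_def similar_def singleton_structure_def)
  then show ?thesis
    by (simp add: Pol_def finfuns_def conj_assoc)
qed


section \<open>Idempotent functions and fixing pairs\<close>

fun idempotent :: "(bool, bool) finfun \<Rightarrow> bool" where
  "idempotent (n, f) \<longleftrightarrow> (\<forall>a. f (replicate n a) = a)"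

fun fixing_pair :: "(bool, bool) finfun \<Rightarrow> nat \<Rightarrow> nat \<Rightarrow> bool" where
  "fixing_pair (n, f) i j \<longleftrightarrow>
     i < n \<and> j < n \<and> i \<noteq> j \<and>
     (\<forall>a \<in> nlists n UNIV. \<not> a ! i \<and> a ! j \<longrightarrow> f a = False) \<and>
     (\<forall>a \<in> nlists n UNIV. a ! i \<and> \<not> a ! j \<longrightarrow> f a = True)"

end

theory Submission
  imports Defs
begin

text \<open>
  A function in \<open>ST\<close> is a decision list: run through pairs \<open>(i, j)\<close> of coordinates, answer
  \<open>x\<^sub>i\<close> at the first pair with \<open>x\<^sub>i \<noteq> x\<^sub>j\<close>, and answer a default coordinate if there is none.
  Such functions preserve the relations because \<open>R\<close> and \<open>2in4\<close> are antichains of non-constant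
  tuples; and a function with fixing pairs in all non-unary minors is such a decision list, because
  one can split off a fixing pair and identify its two coordinates.

  For the remaining implication, view a polymorphism as a family of \<^emph>\<open>large\<close> sets of
  coordinates. Then complements of large sets are small, disjoint unions of large (small) sets are
  large (small), and so membership is monotone in the coordinates \<open>L\<close> with large singletons and
  antitone in the others, \<open>S\<close>. A pair \<open>(i, j)\<close> is fixing iff \<open>{i} \<union> (S - {j})\<close> is large. If
  there is no fixing pair, then induction (identifying two elements of \<open>L\<close> or two of \<open>S\<close>)
  together with the exchange property given by \<open>2in4\<close> yields \<open>i \<in> L\<close> such that all
  \<open>{i} \<union> (S - {j, j'})\<close> are large, and \<open>q \<in> S\<close> such that all \<open>{l, l'} \<union> (S - {q})\<close> are
  large, which leads to a violation of the relation \<open>R\<close>.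
\<close>

section \<open>Decision lists\<close>

fun stair :: "(nat \<times> nat) list \<Rightarrow> nat \<Rightarrow> (nat \<Rightarrow> bool) \<Rightarrow> bool" where
  "stair [] d x = x d"
| "stair ((i, j) # ps) d x = (if x i \<noteq> x j then x i else stair ps d x)"

lemma stair_comp:
  "stair ps d (\<lambda>i. x (\<pi> i)) = stair (map (map_prod \<pi> \<pi>) ps) (\<pi> d) x"
  by (induction ps) (auto split: if_splits)

lemma stair_cong:
  assumes "d < n" "set ps \<subseteq> {..<n} \<times> {..<n}" "\<And>i. i < n \<Longrightarrow> x i = y i"
  shows "stair ps d x = stair ps d y"
  using assms by (induction ps) (auto split: if_splits)

text \<open>Coordinates may repeat, and a pair \<open>(i, i)\<close> is allowed but never decides.
  This makes the class closed under identifying variables.\<close>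

definition is_stair :: "nat \<Rightarrow> (bool list \<Rightarrow> bool) \<Rightarrow> bool" where
  "is_stair n f \<longleftrightarrow> (\<exists>ps d. d < n \<and> set ps \<subseteq> {..<n} \<times> {..<n} \<and>
     (\<forall>a \<in> nlists n UNIV. f a = stair ps d (\<lambda>i. a ! i)))"

lemma nlists_UNIV_iff: "a \<in> nlists n UNIV \<longleftrightarrow> length a = n"
  by (simp add: in_nlists_UNIV)

lemma is_stairI:
  assumes "d < n" "set ps \<subseteq> {..<n} \<times> {..<n}"
    and "\<And>a. length a = n \<Longrightarrow> f a = stair ps d (\<lambda>i. a ! i)"
  shows "is_stair n f"
  unfolding is_stair_def using assms
  by (intro exI[of _ ps] exI[of _ d]) (simp add: nlists_UNIV_iff)

lemma is_stair_minor:
  assumes "is_stair n f" "minor_of UNIV UNIV (m, g) (n, f)"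
  shows "is_stair m g"
proof -
  obtain ps d where ps: "d < n" "set ps \<subseteq> {..<n} \<times> {..<n}"
    "\<And>a. length a = n \<Longrightarrow> f a = stair ps d (\<lambda>i. a ! i)"
    using assms(1) by (auto simp: is_stair_def nlists_UNIV_iff)
  obtain \<pi> where \<pi>: "\<pi> \<in> {..<n} \<rightarrow> {..<m}"
    "\<And>a. length a = m \<Longrightarrow> g a = f (map (\<lambda>i. a ! \<pi> i) [0..<n])"
    using assms(2) by (auto simp: nlists_UNIV_iff)
  have "g a = stair (map (map_prod \<pi> \<pi>) ps) (\<pi> d) (\<lambda>i. a ! i)" if "length a = m" for a
  proof -
    have "g a = stair ps d (\<lambda>i. map (\<lambda>i. a ! \<pi> i) [0..<n] ! i)"
      using that by (simp add: \<pi>(2) ps(3))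
    also have "\<dots> = stair ps d (\<lambda>i. a ! \<pi> i)"
      by (rule stair_cong[OF ps(1,2)]) simp
    finally show ?thesis by (simp add: stair_comp[of _ _ "\<lambda>i. a ! i" \<pi>])
  qed
  moreover have "\<pi> d < m" "set (map (map_prod \<pi> \<pi>) ps) \<subseteq> {..<m} \<times> {..<m}"
    using ps(1,2) \<pi>(1) by auto
  ultimately show ?thesis
    by (intro is_stairI)
qed

text \<open>For \<open>k \<ge> 1\<close>, coordinates \<open>2 * k - 1\<close> and
  \<open>2 * k\<close> of \<open>st_tuple m\<close> carry the weights \<open>2 ^ k\<close> and
  \<open>- (2 ^ k)\<close>. The pairs are listed by decreasing absolute weight, because the heaviest
  pair decides first.\<close>

fun std_pairs :: "nat \<Rightarrow> (nat \<times> nat) list" where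
  "std_pairs 0 = []"
| "std_pairs (Suc m) = (2 * m + 1, 2 * m + 2) # std_pairs m"

lemma set_std_pairs: "set (std_pairs m) \<subseteq> {..<2 * m + 1} \<times> {..<2 * m + 1}"
  by (induction m) auto

lemma st_tuple_Suc: "st_tuple (Suc m) = st_tuple m @ [2 ^ Suc m, - (2 ^ Suc m)]"
  by (simp add: st_tuple_def)

text \<open>
  The sum of all but the last two terms lies strictly between \<open>- 2 ^ Suc m\<close> and \<open>2 ^ Suc m\<close>,
  so the last pair decides the sign unless its two coordinates agree.
\<close>

lemma st_sum:
  fixes x :: "nat \<Rightarrow> bool" and m :: nat
  defines "T \<equiv> \<Sum>i<2 * m + 1. st_tuple m ! i * of_bool (x i)"
  shows "2 - 2 ^ Suc m \<le> T \<and> T \<le> 2 ^ Suc m - 1 \<and> (T > 0 \<longleftrightarrow> stair (std_pairs m) 0 x)"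
  unfolding T_def
proof (induction m)
  case 0
  show ?case by (simp add: st_tuple_def)
next
  case (Suc m)
  define T where "T = (\<Sum>i<2 * m + 1. st_tuple m ! i * of_bool (x i))"
  have "(\<Sum>i<2 * Suc m + 1. st_tuple (Suc m) ! i * of_bool (x i)) =
      (\<Sum>i<2 * m + 1. st_tuple (Suc m) ! i * of_bool (x i)) +
      2 ^ Suc m * of_bool (x (2 * m + 1)) - 2 ^ Suc m * of_bool (x (2 * m + 2))"
    by (simp add: st_tuple_Suc nth_append length_st_tuple)
  also have "(\<Sum>i<2 * m + 1. st_tuple (Suc m) ! i * of_bool (x i)) = T"
    unfolding T_def by (rule sum.cong) (auto simp: st_tuple_Suc nth_append length_st_tuple)
  finally have eq: "(\<Sum>i<2 * Suc m + 1. st_tuple (Suc m) ! i * of_bool (x i)) =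
    T + 2 ^ Suc m * of_bool (x (2 * m + 1)) - 2 ^ Suc m * of_bool (x (2 * m + 2))" .
  have T: "2 - 2 ^ Suc m \<le> T" "T \<le> 2 ^ Suc m - 1" "T > 0 \<longleftrightarrow> stair (std_pairs m) 0 x"
    using Suc.IH by (simp_all only: T_def)
  have pw: "(2::real) ^ Suc (Suc m) = 2 * 2 ^ Suc m" "(2::real) ^ Suc m \<ge> 2"
    by (simp_all add: self_le_power)
  show ?case
    unfolding eq pw(1)
    using T pw(2) by (cases "x (2 * m + 1)"; cases "x (2 * m + 2)") simp_all
qed

lemma threshold_st_tuple:
  assumes "length a = 2 * m + 1"
  shows "snd (threshold (st_tuple m) 0) a = stair (std_pairs m) 0 (\<lambda>i. a ! i)"
  using assms st_sum[of m "\<lambda>i. a ! i"]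
  by (simp add: threshold_def length_st_tuple nlists_UNIV_iff not_le del: sum.lessThan_Suc)

text \<open>The standard list uses no coordinate twice and keeps 0 for the default, so the images of
  its coordinates can be prescribed freely.\<close>

lemma std_pairs_minor:
  assumes "d < n" "set ps \<subseteq> {..<n} \<times> {..<n}"
  shows "\<exists>\<pi>. map (map_prod \<pi> \<pi>) (std_pairs (length ps)) = ps \<and> \<pi> 0 = d \<and>
    \<pi> \<in> {..<2 * length ps + 1} \<rightarrow> {..<n}"
  using assms(2)
proof (induction ps)
  case Nil
  show ?case using assms(1) by (intro exI[of _ "\<lambda>_. d"]) auto
next
  case (Cons p ps)
  obtain i j where p: "p = (i, j)" by (cases p)
  define m where "m = length ps"
  obtain \<pi> where \<pi>: "map (map_prod \<pi> \<pi>) (std_pairs m) = ps" "\<pi> 0 = d"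
    "\<pi> \<in> {..<2 * m + 1} \<rightarrow> {..<n}"
    using Cons by (auto simp: m_def)
  define \<pi>' where "\<pi>' = \<pi>(2 * m + 1 := i, 2 * m + 2 := j)"
  have "map (map_prod \<pi>' \<pi>') (std_pairs m) = map (map_prod \<pi> \<pi>) (std_pairs m)"
    using set_std_pairs[of m] by (intro map_cong) (auto simp: \<pi>'_def)
  moreover have "\<pi>' \<in> {..<2 * Suc m + 1} \<rightarrow> {..<n}"
  proof
    fix k assume "k \<in> {..<2 * Suc m + 1}"
    then have "k < 2 * m + 1 \<or> k = 2 * m + 1 \<or> k = 2 * m + 2" by auto
    then show "\<pi>' k \<in> {..<n}"
      using \<pi>(3) Cons.prems by (auto simp: \<pi>'_def p)
  qed
  ultimately show ?case
    using \<pi>(1,2) by (intro exI[of _ \<pi>']) (auto simp: m_def[symmetric] p, auto simp: \<pi>'_def)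
qed

text \<open>Decision lists form a minion that contains the generators, hence all of
  \<open>ST\<close>. Conversely, renaming the coordinates of a standard list exhibits every decision
  list as a minor of a generator.\<close>

lemma ST_iff:
  assumes "(n, f) \<in> finfuns UNIV UNIV"
  shows "(n, f) \<in> ST \<longleftrightarrow> is_stair n f"
proof
  define M where "M = {(n, f). (n, f) \<in> finfuns UNIV UNIV \<and> is_stair n f}"
  have "minion UNIV UNIV M"
  proof (rule minionI)
    show "G \<in> M" if "F \<in> M" "minor_of UNIV UNIV G F" for F G
      using that is_stair_minor minor_of_finfuns(1)[OF that(2)]
      by (cases F, cases G) (simp add: M_def del: minor_of.simps, blast)
  qed (auto simp: M_def)
  moreover have "threshold (st_tuple m) 0 \<in> M" for m
  proof -
    define g where "g = snd (threshold (st_tuple m) 0)"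
    have g: "threshold (st_tuple m) 0 = (2 * m + 1, g)"
      by (simp add: threshold_def length_st_tuple g_def)
    have g': "g a = stair (std_pairs m) 0 (\<lambda>i. a ! i)" if "length a = 2 * m + 1" for a
      unfolding g_def using that by (rule threshold_st_tuple)
    have "is_stair (2 * m + 1) g"
      using g' set_std_pairs[of m] by (intro is_stairI[of 0]) simp_all
    moreover have "st_tuple m \<noteq> []" by (simp add: st_tuple_def)
    ultimately show ?thesis
      using threshold_finfuns[of "st_tuple m" 0] unfolding g by (simp add: M_def)
  qed
  ultimately have "ST \<subseteq> M"
    unfolding ST_def by (intro hull_minimal) blast+
  then show "is_stair n f" if "(n, f) \<in> ST" using that by (auto simp: M_def)
next
  assume "is_stair n f"
  then obtain ps d where ps: "d < n" "set ps \<subseteq> {..<n} \<times> {..<n}"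
    "\<And>a. length a = n \<Longrightarrow> f a = stair ps d (\<lambda>i. a ! i)"
    by (auto simp: is_stair_def nlists_UNIV_iff)
  define m where "m = length ps"
  obtain \<pi> where \<pi>: "map (map_prod \<pi> \<pi>) (std_pairs m) = ps" "\<pi> 0 = d"
    "\<pi> \<in> {..<2 * m + 1} \<rightarrow> {..<n}"
    using std_pairs_minor[OF ps(1,2)] by (auto simp: m_def)
  define g where "g = snd (threshold (st_tuple m) 0)"
  have g: "threshold (st_tuple m) 0 = (2 * m + 1, g)"
    by (simp add: threshold_def length_st_tuple g_def)
  have g': "g a = stair (std_pairs m) 0 (\<lambda>i. a ! i)" if "length a = 2 * m + 1" for a
    unfolding g_def using that by (rule threshold_st_tuple)
  have "f a = g (map (\<lambda>i. a ! \<pi> i) [0..<2 * m + 1])" if "length a = n" for a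
  proof -
    have "g (map (\<lambda>i. a ! \<pi> i) [0..<2 * m + 1]) =
        stair (std_pairs m) 0 (\<lambda>i. map (\<lambda>i. a ! \<pi> i) [0..<2 * m + 1] ! i)"
      by (rule g') simp
    also have "\<dots> = stair (std_pairs m) 0 (\<lambda>i. a ! \<pi> i)"
      by (rule stair_cong[of _ "2 * m + 1"]) (use set_std_pairs[of m] in \<open>auto simp del: upt_Suc\<close>)
    also have "\<dots> = f a"
      using that by (simp add: stair_comp[of _ _ "\<lambda>i. a ! i" \<pi>] \<pi> ps(3))
    finally show ?thesis ..
  qed
  moreover have "threshold (st_tuple m) 0 \<in> finfuns UNIV UNIV"
    by (rule threshold_finfuns) (simp add: st_tuple_def)
  ultimately have minor: "minor_of UNIV UNIV (n, f) (threshold (st_tuple m) 0)"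
    unfolding g minor_of.simps nlists_UNIV_iff
    by (intro conjI bexI[of _ \<pi>] ballI) (use assms \<pi>(3) in \<open>simp_all only: nlists_UNIV_iff\<close>)
  have "threshold (st_tuple m) 0 \<in> ST"
    unfolding ST_def by (rule hull_inc) blast
  then show "(n, f) \<in> ST"
    using minor by (rule minionD[OF minion_ST])
qed


section \<open>Decision lists are polymorphisms\<close>

lemma Pol_ST_iff:
  "(n, f) \<in> Pol ST_L ST_R \<longleftrightarrow> (n, f) \<in> finfuns UNIV UNIV \<and>
     (\<forall>(k, R) \<in> {(6, ST_rel), (4, two_in_four)}. \<forall>xs \<in> nlists k (nlists n UNIV).
        (\<forall>i<n. map (\<lambda>x. x ! i) xs \<in> R) \<longrightarrow> map f xs \<in> NAE k)"
  unfolding Pol_def homs_def finfuns_def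
  by (auto simp: similar_power similar_ST)
     (auto simp: power_structure_def ST_L_def ST_R_def less_Suc_eq numeral_2_eq_2)

lemma length_4_conv: "length xs = 4 \<longleftrightarrow> (\<exists>a b c d. xs = [a, b, c, d])"
  by (simp add: eval_nat_numeral length_Suc_conv) blast

lemma two_in_four_eq:
  "two_in_four =
     {[True, True, False, False], [True, False, True, False], [True, False, False, True],
      [False, True, True, False], [False, True, False, True], [False, False, True, True]}" (is "_ = ?R")
proof (rule set_eqI)
  fix xs :: "bool list"
  show "xs \<in> two_in_four \<longleftrightarrow> xs \<in> ?R"
  proof (cases "length xs = 4")
    case True
    then obtain a b c d where "xs = [a, b, c, d]" unfolding length_4_conv by blast
    then show ?thesis
      by (cases a; cases b; cases c; cases d) (simp_all add: two_in_four_def nlists_UNIV_iff)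
  next
    case False
    then show ?thesis by (auto simp: two_in_four_def nlists_UNIV_iff)
  qed
qed

lemma antichain_two_in_four:
  assumes "c \<in> two_in_four" "c' \<in> two_in_four" "c \<noteq> c'"
  shows "\<exists>r<4. c ! r \<and> \<not> c' ! r"
  using assms unfolding two_in_four_eq by (elim insertE emptyE) (simp_all add: eval_nat_numeral Ex_less_Suc)

text \<open>Viewed as sets of positions, the tuples are two disjoint triples and three disjoint
  pairs, and each pair meets each triple in a single position.\<close>

lemma antichain_ST_rel:
  assumes "c \<in> ST_rel" "c' \<in> ST_rel" "c \<noteq> c'"
  shows "\<exists>r<6. c ! r \<and> \<not> c' ! r"
  using assms unfolding ST_rel_def by (elim insertE emptyE) (simp_all add: eval_nat_numeral Ex_less_Suc)

lemma nonconst_two_in_four: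
  assumes "c \<in> two_in_four"
  shows "\<exists>r<4. c ! r" "\<exists>r<4. \<not> c ! r"
  using assms unfolding two_in_four_eq by (auto simp: eval_nat_numeral Ex_less_Suc)

lemma nonconst_ST_rel:
  assumes "c \<in> ST_rel"
  shows "\<exists>r<6. c ! r" "\<exists>r<6. \<not> c ! r"
  using assms unfolding ST_rel_def by (auto simp: eval_nat_numeral Ex_less_Suc)

lemma stair_NAE:
  fixes x :: "nat \<Rightarrow> nat \<Rightarrow> bool"
  assumes anti: "\<And>i j. i < n \<Longrightarrow> j < n \<Longrightarrow> (\<exists>r<k. x r i \<noteq> x r j) \<Longrightarrow> \<exists>r<k. x r i \<and> \<not> x r j"
    and nonconst: "\<And>i. i < n \<Longrightarrow> (\<exists>r<k. x r i) \<and> (\<exists>r<k. \<not> x r i)"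
    and "d < n" "set ps \<subseteq> {..<n} \<times> {..<n}"
  shows "(\<exists>r<k. stair ps d (x r)) \<and> (\<exists>r<k. \<not> stair ps d (x r))"
  using assms(4)
proof (induction ps)
  case Nil
  show ?case using nonconst[OF \<open>d < n\<close>] by simp
next
  case (Cons p ps)
  obtain i j where p: "p = (i, j)" "i < n" "j < n" using Cons.prems by (cases p) auto
  show ?case
  proof (cases "\<exists>r<k. x r i \<noteq> x r j")
    case True
    then show ?thesis
      using anti[of i j] anti[of j i] p by (metis stair.simps(2))
  next
    case False
    then show ?thesis using Cons p by auto
  qed
qed

lemma is_stair_Pol:
  assumes "(n, f) \<in> finfuns UNIV UNIV" "is_stair n f"
  shows "(n, f) \<in> Pol ST_L ST_R"
proof -
  obtain ps d where ps: "d < n" "set ps \<subseteq> {..<n} \<times> {..<n}"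
    "\<And>a. length a = n \<Longrightarrow> f a = stair ps d (\<lambda>i. a ! i)"
    using assms(2) by (auto simp: is_stair_def nlists_UNIV_iff)
  have "map f xs \<in> NAE k"
    if R: "(k, R) \<in> {(6, ST_rel), (4, two_in_four)}"
      and xs: "xs \<in> nlists k (nlists n UNIV)" "\<forall>i<n. map (\<lambda>x. x ! i) xs \<in> R" for k R xs
  proof -
    have len: "length xs = k" "\<And>r. r < k \<Longrightarrow> length (xs ! r) = n"
      using xs(1) by (auto simp: nlists_def subset_iff simp del: nlistsE_length nlistsE_set)
    \<comment> \<open>The lists in \<open>xs\<close> are the rows of a matrix, and
      \<open>c i\<close> is its column \<open>i\<close>.\<close>
    define c where "c i = map (\<lambda>x. x ! i) xs" for i
    have c: "c i \<in> R" "length (c i) = k" "r < k \<Longrightarrow> c i ! r = xs ! r ! i" if "i < n" for i r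
      using that xs(2) len by (simp_all add: c_def)
    have "\<exists>r<k. xs ! r ! i \<and> \<not> xs ! r ! j" if "i < n" "j < n" "\<exists>r<k. xs ! r ! i \<noteq> xs ! r ! j" for i j
    proof -
      have "c i \<noteq> c j" using that c(3) by metis
      then have "\<exists>r<k. c i ! r \<and> \<not> c j ! r"
        using R c(1)[OF that(1)] c(1)[OF that(2)] antichain_ST_rel antichain_two_in_four by auto
      then show ?thesis using c(3) that by auto
    qed
    moreover have "(\<exists>r<k. xs ! r ! i) \<and> (\<exists>r<k. \<not> xs ! r ! i)" if "i < n" for i
    proof -
      have "(\<exists>r<k. c i ! r) \<and> (\<exists>r<k. \<not> c i ! r)"
        using R c(1)[OF that] nonconst_ST_rel nonconst_two_in_four by auto
      then show ?thesis using c(3) that by auto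
    qed
    ultimately have "(\<exists>r<k. stair ps d (\<lambda>i. xs ! r ! i)) \<and> (\<exists>r<k. \<not> stair ps d (\<lambda>i. xs ! r ! i))"
      by (rule stair_NAE) (use ps in auto)
    then obtain r s where "r < k" "s < k" "f (xs ! r)" "\<not> f (xs ! s)"
      using ps(3) len by auto
    then show ?thesis
      using len(1) by (auto simp: NAE_def nlists_UNIV_iff) (metis nth_map nth_replicate)
  qed
  then show ?thesis using assms(1) by (auto simp: Pol_ST_iff)
qed

lemma is_stair_idempotent:
  assumes "is_stair n f"
  shows "idempotent (n, f)"
proof -
  obtain ps d where ps: "d < n" "set ps \<subseteq> {..<n} \<times> {..<n}"
    "\<And>a. length a = n \<Longrightarrow> f a = stair ps d (\<lambda>i. a ! i)"
    using assms by (auto simp: is_stair_def nlists_UNIV_iff)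
  have "stair ps d (\<lambda>i. replicate n b ! i) = b" for b
    using ps(1,2) by (induction ps) auto
  then show ?thesis using ps(3) by simp
qed


section \<open>Functions all of whose non-unary minors have a fixing pair\<close>

lemma minor_ofI:
  assumes "(m, g) \<in> finfuns A B" "(n, f) \<in> finfuns A B" "\<pi> \<in> {..<n} \<rightarrow> {..<m}"
    and "\<And>a. a \<in> nlists m A \<Longrightarrow> g a = f (map (\<lambda>i. a ! \<pi> i) [0..<n])"
  shows "minor_of A B (m, g) (n, f)"
  unfolding minor_of.simps using assms by (intro conjI bexI[of _ \<pi>] ballI)

lemma minor_of_refl: "F \<in> finfuns A B \<Longrightarrow> minor_of A B F F"
proof (cases F)
  case (Pair n f)
  assume "F \<in> finfuns A B"
  moreover have "map (\<lambda>i. a ! i) [0..<n] = a" if "a \<in> nlists n A" for a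
    using that by (auto intro: nth_equalityI)
  ultimately show ?thesis
    unfolding Pair by (intro minor_ofI[of _ _ _ _ _ _ "\<lambda>i. i"]) auto
qed

lemma minor_of_trans:
  assumes "minor_of A B H G" "minor_of A B G F"
  shows "minor_of A B H F"
proof -
  obtain n f m g l h where eq: "F = (n, f)" "G = (m, g)" "H = (l, h)" by (cases F, cases G, cases H)
  obtain \<rho> \<pi> where \<rho>: "\<rho> \<in> {..<m} \<rightarrow> {..<l}" "\<And>a. a \<in> nlists l A \<Longrightarrow> h a = g (map (\<lambda>i. a ! \<rho> i) [0..<m])"
    and \<pi>: "\<pi> \<in> {..<n} \<rightarrow> {..<m}" "\<And>a. a \<in> nlists m A \<Longrightarrow> g a = f (map (\<lambda>i. a ! \<pi> i) [0..<n])"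
    using assms unfolding eq minor_of.simps by blast
  have "h a = f (map (\<lambda>i. a ! \<rho> (\<pi> i)) [0..<n])" if a: "a \<in> nlists l A" for a
  proof -
    have "map (\<lambda>i. a ! \<rho> i) [0..<m] \<in> nlists m A"
      using a \<rho>(1) by (auto simp: nlists_def Pi_def simp del: nlistsE_length nlistsE_set)
    then have "h a = f (map (\<lambda>i. map (\<lambda>i. a ! \<rho> i) [0..<m] ! \<pi> i) [0..<n])"
      using \<rho>(2)[OF a] \<pi>(2) by simp
    also have "map (\<lambda>i. map (\<lambda>i. a ! \<rho> i) [0..<m] ! \<pi> i) [0..<n] = map (\<lambda>i. a ! \<rho> (\<pi> i)) [0..<n]"
      using \<pi>(1) by (auto simp: Pi_def)
    finally show ?thesis .
  qed
  moreover have "(\<lambda>i. \<rho> (\<pi> i)) \<in> {..<n} \<rightarrow> {..<l}" using \<rho>(1) \<pi>(1) by auto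
  ultimately show ?thesis
    using minor_of_finfuns(1)[OF assms(1)] minor_of_finfuns(2)[OF assms(2)]
    unfolding eq by (intro minor_ofI)
qed

text \<open>Induction on the arity: a fixing pair \<open>(i, j)\<close> becomes the first pair of
  the list. On tuples with equal entries at \<open>i\<close> and \<open>j\<close>, \<open>f\<close>
  is given by the minor identifying \<open>j\<close> with \<open>i\<close>, and this minor inherits
  the hypotheses because minors compose.\<close>

lemma fixing_pairs_is_stair:
  assumes "(n, f) \<in> finfuns UNIV UNIV" "idempotent (n, f)"
    and "\<And>m g. minor_of UNIV UNIV (m, g) (n, f) \<Longrightarrow> m \<ge> 2 \<Longrightarrow> \<exists>i j. fixing_pair (m, g) i j"
  shows "is_stair n f"
  using assms
proof (induction n arbitrary: f)
  case 0
  then show ?case by (simp add: finfuns_def)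
next
  case (Suc n)
  show ?case
  proof (cases "n = 0")
    case True
    have "f a = a ! 0" if "length a = Suc 0" for a
    proof -
      obtain b where "a = [b]" using \<open>length a = Suc 0\<close> unfolding length_Suc_conv by auto
      then show ?thesis using Suc.prems(2) True by (cases b) simp_all
    qed
    then show ?thesis
      using True by (intro is_stairI[of 0 _ "[]"]) simp_all
  next
    case False
    obtain i j where fp: "fixing_pair (Suc n, f) i j"
      using Suc.prems(3)[OF minor_of_refl[OF Suc.prems(1)]] False by auto
    then have ij: "i < Suc n" "j < Suc n" "i \<noteq> j" by auto
    have "card ({..<Suc n} - {j}) = card {..<n}" using ij by simp
    \<comment> \<open>Minors live on an initial segment of the naturals, so the coordinates other
      than \<open>j\<close> are renumbered by \<open>h\<close>; \<open>h'\<close> is the inverse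
      renumbering.\<close>
    then obtain h where h: "bij_betw h ({..<Suc n} - {j}) {..<n}"
      using finite_same_card_bij by blast
    define h' where "h' = inv_into ({..<Suc n} - {j}) h"
    define \<pi> where "\<pi> v = h (if v = j then i else v)" for v
    define g where "g = (\<lambda>a \<in> nlists n UNIV. f (map (\<lambda>v. a ! \<pi> v) [0..<Suc n]))"
    have g: "(n, g) \<in> finfuns UNIV UNIV"
      using False by (auto simp: finfuns_def g_def)
    have \<pi>: "\<pi> \<in> {..<Suc n} \<rightarrow> {..<n}"
      using h ij by (auto simp: \<pi>_def bij_betw_def)
    have minor: "minor_of UNIV UNIV (n, g) (Suc n, f)"
      using g Suc.prems(1) \<pi> by (rule minor_ofI) (simp add: g_def del: upt_Suc)
    have "idempotent (n, g)"
    proof -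
      have eq: "map (\<lambda>v. replicate n a ! \<pi> v) [0..<Suc n] = replicate (Suc n) a" for a
        using \<pi> by (intro nth_equalityI) (auto simp: Pi_def simp del: upt_Suc replicate_Suc)
      have "g (replicate n a) = f (replicate (Suc n) a)" for a
        unfolding g_def eq[symmetric]
        by (simp only: restrict_apply' nlists_UNIV_iff length_replicate)
      then show ?thesis
        using Suc.prems(2) by (simp only: idempotent.simps) simp
    qed
    with g have "is_stair n g"
    proof (rule Suc.IH)
      show "\<exists>i j. fixing_pair (m, h) i j" if "minor_of UNIV UNIV (m, h) (n, g)" "m \<ge> 2" for m h
        using Suc.prems(3)[OF minor_of_trans[OF that(1) minor] that(2)] .
    qed
    then obtain ps d where ps: "d < n" "set ps \<subseteq> {..<n} \<times> {..<n}"
      "\<And>a. length a = n \<Longrightarrow> g a = stair ps d (\<lambda>i. a ! i)"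
      by (auto simp: is_stair_def nlists_UNIV_iff)
    let ?ps = "(i, j) # map (map_prod h' h') ps"
    have h': "h' v < Suc n" if "v < n" for v
      using bij_betw_inv_into[OF h] that by (auto simp: h'_def bij_betw_def)
    have "f a = stair ?ps (h' d) (\<lambda>i. a ! i)" if a: "length a = Suc n" for a
    proof (cases "a ! i = a ! j")
      case False
      then show ?thesis using fp a by (auto simp: nlists_UNIV_iff)
    next
      case True
      \<comment> \<open>\<open>b\<close> is \<open>a\<close> with entry \<open>j\<close> deleted, in
        the numbering given by \<open>h\<close>.\<close>
      define b where "b = map (\<lambda>k. a ! h' k) [0..<n]"
      have "b ! \<pi> v = a ! v" if "v < Suc n" for v
      proof -
        have "h' (\<pi> v) = (if v = j then i else v)"
          using h ij that unfolding h'_def \<pi>_def by (intro bij_betw_inv_into_left) auto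
        moreover have "\<pi> v < n" using \<pi> that by auto
        ultimately show ?thesis using True by (simp add: b_def)
      qed
      then have "map (\<lambda>v. b ! \<pi> v) [0..<Suc n] = a"
        using a by (intro nth_equalityI) (auto simp del: upt_Suc)
      then have "f a = g b"
        by (simp add: g_def nlists_UNIV_iff b_def del: upt_Suc)
      also have "\<dots> = stair ps d (\<lambda>k. b ! k)" by (simp add: ps(3) b_def)
      also have "\<dots> = stair ps d (\<lambda>k. a ! h' k)"
        by (rule stair_cong[OF ps(1,2)]) (simp add: b_def)
      finally show ?thesis
        using True by (simp add: stair_comp[of _ _ "\<lambda>i. a ! i" h'])
    qed
    moreover have "h' d < Suc n" "set ?ps \<subseteq> {..<Suc n} \<times> {..<Suc n}"
      using ps(1,2) ij h' by auto
    ultimately show ?thesis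
      by (intro is_stairI)
  qed
qed


section \<open>Polymorphisms as families of large sets\<close>

text \<open>A set stands for its characteristic tuple. \<open>V\<close> is an arbitrary finite set,
  so that two coordinates can be identified by deleting one of them, without renumbering.
  \<open>F\<close> takes all sets of naturals but sees only their trace on \<open>V\<close>, so
  complements may be taken in the whole type.\<close>

locale large_sets =
  fixes V :: "nat set" and F :: "nat set \<Rightarrow> bool"
  assumes finite_V: "finite V"
    and restrict: "X \<inter> V = Y \<inter> V \<Longrightarrow> F X = F Y"
    and small_empty: "\<not> F {}"
    and large_V: "F V"
    and two_in_four: "\<forall>v\<in>V. [v \<in> X\<^sub>1, v \<in> X\<^sub>2, v \<in> X\<^sub>3, v \<in> X\<^sub>4] \<in> two_in_four \<Longrightarrow>
      \<not> (\<forall>X \<in> {X\<^sub>1, X\<^sub>2, X\<^sub>3, X\<^sub>4}. F X = b)"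
    and ST_rel: "\<forall>v\<in>V. [v \<in> X\<^sub>1, v \<in> X\<^sub>2, v \<in> X\<^sub>3, v \<in> X\<^sub>4, v \<in> X\<^sub>5, v \<in> X\<^sub>6] \<in> ST_rel \<Longrightarrow>
      \<not> (\<forall>X \<in> {X\<^sub>1, X\<^sub>2, X\<^sub>3, X\<^sub>4, X\<^sub>5, X\<^sub>6}. F X = b)"

text \<open>In terms of sets, taking a minor along \<open>m\<close> means pulling sets back, and
  pulling back preserves the membership pattern of each coordinate.\<close>

lemma large_sets_vimage:
  assumes "large_sets V F" "m \<in> V \<rightarrow> W" "finite W"
  shows "large_sets W (\<lambda>X. F (m -` X))"
proof -
  interpret large_sets V F by fact
  have m: "m v \<in> W" if "v \<in> V" for v using that assms(2) by auto
  show ?thesis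
  proof
    show "F (m -` X) = F (m -` Y)" if "X \<inter> W = Y \<inter> W" for X Y
      using that m by (intro restrict) blast
    have "F (m -` W) = F V" using m by (intro restrict) auto
    then show "F (m -` W)" using large_V by simp
  next
    fix X1 X2 X3 X4 b
    assume "\<forall>v\<in>W. [v \<in> X1, v \<in> X2, v \<in> X3, v \<in> X4] \<in> two_in_four"
    then show "\<not> (\<forall>X\<in>{X1, X2, X3, X4}. F (m -` X) = b)"
      using two_in_four[of "m -` X1" "m -` X2" "m -` X3" "m -` X4" b] m by simp
  next
    fix X1 X2 X3 X4 X5 X6 b
    assume "\<forall>v\<in>W. [v \<in> X1, v \<in> X2, v \<in> X3, v \<in> X4, v \<in> X5, v \<in> X6] \<in> ST_rel"
    then show "\<not> (\<forall>X\<in>{X1, X2, X3, X4, X5, X6}. F (m -` X) = b)"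
      using ST_rel[of "m -` X1" "m -` X2" "m -` X3" "m -` X4" "m -` X5" "m -` X6" b] m by simp
  qed (use assms(3) small_empty in simp_all)
qed

section \<open>Consequences of the two relations for large sets\<close>

context large_sets
begin

text \<open>Every coordinate lies in exactly two of \<open>X, X, - X, - X\<close>, so
  \<open>X\<close> and \<open>- X\<close> cannot get the same value.\<close>

lemma compl: "F (- X) \<longleftrightarrow> \<not> F X"
  using two_in_four[of X X "- X" "- X" "F X"] by (auto simp: two_in_four_def nlists_UNIV_iff)

text \<open>By the counting condition each coordinate lies in exactly two of
  \<open>X, Y, - X', - Y'\<close>. If \<open>X'\<close> and \<open>Y'\<close> were both small, all
  four of these sets would be large.\<close>

lemma exchange:
  assumes "F X" "F Y"
    and "\<And>v. v \<in> V \<Longrightarrow>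
      of_bool (v \<in> X) + of_bool (v \<in> Y) = (of_bool (v \<in> X') + of_bool (v \<in> Y') :: nat)"
  shows "F X' \<or> F Y'"
proof -
  have "[v \<in> X, v \<in> Y, v \<in> - X', v \<in> - Y'] \<in> two_in_four" if "v \<in> V" for v
    using assms(3)[OF that]
    by (cases "v \<in> X"; cases "v \<in> Y"; cases "v \<in> X'"; cases "v \<in> Y'")
      (simp_all add: two_in_four_def nlists_UNIV_iff)
  then show ?thesis
    using two_in_four[of X Y "- X'" "- Y'" True] assms(1,2) compl[of X'] compl[of Y'] by auto
qed

text \<open>With \<open>Z\<close> the complement of the union, each coordinate lies in exactly one
  of X, Y, Z. Doubling each set gives the three tuples of \<open>ST_rel\<close> with two ones, so
  \<open>Z\<close> must get the other value.\<close>

lemma disjoint_union: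
  assumes "X \<inter> Y = {}" "F X = F Y"
  shows "F (X \<union> Y) = F X"
proof -
  let ?Z = "- (X \<union> Y)"
  have "[v \<in> X, v \<in> X, v \<in> Y, v \<in> Y, v \<in> ?Z, v \<in> ?Z] \<in> ST_rel" for v
    using assms(1) by (auto simp: ST_rel_def)
  then show ?thesis
    using ST_rel[of X X Y Y ?Z ?Z "F X"] assms(2) compl[of "X \<union> Y"] by auto
qed

definition L :: "nat set" where "L = {v \<in> V. F {v}}"

definition S :: "nat set" where "S = {v \<in> V. \<not> F {v}}"

lemma L_S: "L \<union> S = V" "L \<inter> S = {}" "finite L" "finite S"
  using finite_V by (auto simp: L_def S_def)

lemma V_iff: "v \<in> V \<longleftrightarrow> v \<in> L \<or> v \<in> S"
  by (auto simp: L_def S_def)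

lemma L_not_S: "v \<in> L \<Longrightarrow> v \<notin> S"
  by (auto simp: L_def S_def)

lemma large_union:
  assumes "F X" "A \<subseteq> L"
  shows "F (X \<union> A)"
  using finite_subset[OF assms(2) L_S(3)] assms(2)
proof (induction A)
  case (insert v A)
  then have "F (X \<union> A)" "F {v}" by (auto simp: L_def)
  then show ?case
    using disjoint_union[of "X \<union> A" "{v}"] by (cases "v \<in> X \<union> A") (auto simp: insert_absorb)
qed (use assms(1) in simp)

lemma large_diff:
  assumes "F X" "B \<subseteq> S"
  shows "F (X - B)"
  using finite_subset[OF assms(2) L_S(4)] assms(2)
proof (induction B)
  case (insert v B)
  then have *: "F (X - B)" "\<not> F {v}" by (auto simp: S_def)
  show ?case
  proof (rule ccontr)
    assume **: "\<not> F (X - insert v B)"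
    then have "\<not> F ((X - insert v B) \<union> {v})"
      using *(2) disjoint_union[of "X - insert v B" "{v}"] by auto
    moreover have "(X - insert v B) \<union> {v} = X - B" if "v \<in> X - B" using that by auto
    moreover have "X - insert v B = X - B" if "v \<notin> X - B" using that by auto
    ultimately show False using * ** by metis
  qed
qed (use assms(1) in simp)

text \<open>Within \<open>V\<close>, \<open>X\<close> is turned into \<open>Y\<close> by adding
  elements of \<open>L\<close> and deleting elements of \<open>S\<close>, and neither move destroys
  largeness.\<close>

lemma large_mono:
  assumes "F X" "X \<inter> L \<subseteq> Y" "Y \<inter> S \<subseteq> X"
  shows "F Y"
proof -
  have "F ((X \<union> (Y \<inter> L)) - (S - Y))"
    using assms(1) by (intro large_diff large_union) auto
  also have "F ((X \<union> (Y \<inter> L)) - (S - Y)) = F Y"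
    using assms(2,3) L_S(1,2) by (intro restrict) blast
  finally show ?thesis .
qed

lemma large_iff_small:
  assumes "X \<inter> Y = {}" "V \<subseteq> X \<union> Y"
  shows "F X \<longleftrightarrow> \<not> F Y"
proof -
  have "F X = F (- Y)" using assms by (intro restrict) auto
  then show ?thesis using compl by simp
qed

lemma large_L:
  assumes "A \<subseteq> L" "A \<noteq> {}"
  shows "F A"
proof -
  obtain a where "a \<in> A" using assms(2) by auto
  moreover have "F {a}" "A \<inter> S = {}"
    using assms(1) \<open>a \<in> A\<close> by (auto simp: L_def S_def)
  ultimately show ?thesis
    by (intro large_mono[of "{a}" A]) auto
qed

lemma small_S:
  assumes "B \<subseteq> S"
  shows "\<not> F B"
  using large_mono[of B "{}"] small_empty assms L_S(2) by blast

text \<open>This uses all five tuples of \<open>ST_rel\<close>: elements of \<open>P\<close> and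
  \<open>Q\<close> yield the two alternating tuples, and \<open>a\<close>, \<open>b\<close>,
  \<open>c\<close> yield the other three.\<close>

lemma partition_not_constant:
  assumes "distinct [a, b, c]" "{a, b, c} \<inter> (P \<union> Q) = {}" "P \<inter> Q = {}" "V \<subseteq> P \<union> Q \<union> {a, b, c}"
  shows "\<exists>x\<in>{a, b, c}. F (insert x P) \<noteq> t \<or> F (insert x Q) \<noteq> t"
proof -
  have "[v \<in> insert a P, v \<in> insert a Q, v \<in> insert b P, v \<in> insert b Q,
      v \<in> insert c P, v \<in> insert c Q] \<in> ST_rel" if v: "v \<in> V" for v
  proof -
    consider "v = a" | "v = b" | "v = c" | "v \<notin> {a, b, c}" "v \<in> P" | "v \<notin> {a, b, c}" "v \<in> Q"
      using v assms(4) by blast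
    then show ?thesis
      using assms(1-3) by cases (auto simp: ST_rel_def)
  qed
  then show ?thesis
    using ST_rel[of "insert a P" "insert a Q" "insert b P" "insert b Q" "insert c P" "insert c Q" t]
    by blast
qed

text \<open>For a retraction \<open>m\<close> that respects the two sides, the fibre of
  \<open>p\<close> is large, so it cannot lie inside \<open>S\<close>. The fibre of \<open>q\<close>
  is small and nonempty, so it cannot lie inside \<open>L\<close>.\<close>

lemma fixing_sides:
  assumes "m \<in> V \<rightarrow> W" "p \<in> W" "q \<in> W" "W \<subseteq> V" "\<And>w. w \<in> W \<Longrightarrow> m w = w"
    and sides: "\<And>v. v \<in> V \<Longrightarrow> m v \<in> L \<longleftrightarrow> v \<in> L"
    and fp: "\<And>X. p \<in> X \<Longrightarrow> q \<notin> X \<Longrightarrow> F (m -` X)" "p \<noteq> q"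
  shows "p \<in> L" "q \<in> S"
proof -
  have *: "F (m -` X \<inter> V) = F (m -` X)" for X by (rule restrict) auto
  have "F (m -` {p} \<inter> V)" using fp * by simp
  moreover have "m -` {p} \<inter> V \<subseteq> S" if "p \<notin> L" using that sides L_S(1) by auto
  ultimately show "p \<in> L" using small_S by metis
  have "F (- (m -` {q}))" using fp(1)[of "- {q}"] fp(2) by (simp add: vimage_Compl)
  then have "\<not> F (m -` {q} \<inter> V)" using * compl by simp
  moreover have "m -` {q} \<inter> V \<subseteq> L" if "q \<in> L" using that sides by auto
  moreover have "q \<in> m -` {q} \<inter> V" using assms by auto
  ultimately have "q \<notin> L" using large_L by blast
  then show "q \<in> S" using assms(3,4) L_S(1) by auto
qed

end

section \<open>Existence of fixing pairs, by induction on the number of coordinates\<close>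

lemma chain_greatest:
  assumes "finite A" "A \<noteq> {}" "\<And>x y. x \<in> A \<Longrightarrow> y \<in> A \<Longrightarrow> G x \<subseteq> G y \<or> G y \<subseteq> G x"
  shows "\<exists>x\<in>A. \<forall>y\<in>A. G y \<subseteq> (G x :: 'b set)"
proof -
  have "\<exists>M\<in>G ` A. \<forall>N\<in>G ` A. M \<le> N \<longrightarrow> M = N"
    using assms(1,2) by (intro finite_has_maximal) simp_all
  then obtain x where "x \<in> A" "\<forall>y\<in>A. G x \<subseteq> G y \<longrightarrow> G x = G y" by blast
  then show ?thesis using assms(3) by (intro bexI[of _ x]) blast+
qed

text \<open>Only the positive half of the fixing condition is stated; the other half follows by
  complementation.\<close>

lemma large_sets_fixing_pair:
  assumes "large_sets V F" "card V \<ge> 2"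
  shows "\<exists>i\<in>V. \<exists>j\<in>V. i \<noteq> j \<and> (\<forall>X. i \<in> X \<longrightarrow> j \<notin> X \<longrightarrow> F X)"
  using assms
proof (induction "card V" arbitrary: V F rule: less_induct)
  case less
  interpret large_sets V F by fact
  show ?case
  proof (rule ccontr)
    assume "\<not> ?case"
    then have contra: "\<exists>X. i \<in> X \<and> j \<notin> X \<and> \<not> F X" if "i \<in> V" "j \<in> V" "i \<noteq> j" for i j
      using that by blast
    \<comment> \<open>By \<open>large_mono\<close>, this set is the extreme case among all sets that
      contain \<open>i\<close> and avoid \<open>j\<close>: were it large, all of them would
      be.\<close>
    have N: "\<not> F (insert i (S - {j}))" if "i \<in> L" "j \<in> S" for i j
    proof
      assume *: "F (insert i (S - {j}))"
      have "F X" if "i \<in> X" "j \<notin> X" for X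
        using * by (rule large_mono) (use that L_not_S in blast)+
      moreover have "i \<in> V" "j \<in> V" "i \<noteq> j" using that V_iff L_not_S by blast+
      ultimately show False using contra[of i j] by blast
    qed
    \<comment> \<open>Next, \<open>L\<close> and \<open>S\<close> are shown to have at least two
      elements each, since otherwise a small set would turn out to be large or two complementary
      sets would get the same value.\<close>
    have "L \<noteq> {}" using small_S[of V] large_V L_S(1) by auto
    then obtain l0 where l0: "l0 \<in> L" by auto
    have "V - {l0} \<noteq> {}"
    proof
      assume "V - {l0} = {}"
      then have "card V \<le> card {l0}" by (intro card_mono) auto
      then show False using less.prems(2) by simp
    qed
    then have "S \<noteq> {}"
      using large_L[of "{l0}"] large_L[of "V - {l0}"] l0 L_S(1) large_iff_small[of "{l0}" "V - {l0}"]
      by auto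
    then obtain s0 where s0: "s0 \<in> S" by auto
    have "S - {s0} \<noteq> {}"
    proof
      assume "S - {s0} = {}"
      then have "insert l0 (S - {s0}) = {l0}" by (simp only:)
      moreover have "F {l0}" using l0 by (simp add: L_def)
      ultimately show False using N[OF l0 s0] by metis
    qed
    then obtain s1 where s1: "s1 \<in> S" "s1 \<noteq> s0" by auto
    have "L - {l0} \<noteq> {}"
    proof
      assume "L - {l0} = {}"
      then have "F (insert l0 (S - {s0})) \<longleftrightarrow> \<not> F {s0}"
        using l0 s0 by (intro large_iff_small) (auto simp: V_iff dest: L_not_S)
      then show False using N[OF l0 s0] small_S[of "{s0}"] s0 by auto
    qed
    then obtain l1 where l1: "l1 \<in> L" "l1 \<noteq> l0" by auto
    \<comment> \<open>Identifying \<open>v\<close> with \<open>u\<close> on the same side leaves at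
      least two coordinates, so the induction hypothesis gives a fixing pair \<open>(p, q)\<close>
      of the minor, and \<open>fixing_sides\<close> locates it.\<close>
    have merge: "\<exists>p\<in>L. \<exists>q\<in>S. p \<noteq> v \<and> q \<noteq> v \<and> F (id(v := u) -` insert p (S - {q}))"
      if uv: "u \<in> V" "v \<in> V" "u \<noteq> v" "u \<in> L \<longleftrightarrow> v \<in> L" for u v
    proof -
      let ?m = "id(v := u)" and ?W = "V - {v}"
      have m: "?m \<in> V \<rightarrow> ?W" using uv by auto
      have "l0 \<noteq> s0" "l0 \<noteq> s1" using l0 s0 s1 L_not_S by blast+
      then have "{l0, s0, s1} \<subseteq> V" "card {l0, s0, s1} = 3"
        using l0 s0 s1 by (simp_all add: V_iff)
      then have "3 \<le> card V" using card_mono[OF finite_V, of "{l0, s0, s1}"] by simp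
      then have "2 \<le> card ?W" "card ?W < card V" using uv(2) finite_V by auto
      moreover have "large_sets ?W (\<lambda>X. F (?m -` X))"
        using m finite_V by (intro large_sets_vimage[OF less.prems(1)]) auto
      ultimately obtain p q where pq: "p \<in> ?W" "q \<in> ?W" "p \<noteq> q"
        and fp: "\<And>X. p \<in> X \<Longrightarrow> q \<notin> X \<Longrightarrow> F (?m -` X)"
        using less.hyps[of ?W "\<lambda>X. F (?m -` X)"] by auto
      have "p \<in> L" "q \<in> S"
        using fixing_sides[OF m pq(1,2) _ _ _ fp pq(3)] uv by auto
      then show ?thesis using fp[of "insert p (S - {q})"] pq by (auto dest: L_not_S)
    qed
    \<comment> \<open>Here \<open>p\<close> must be the merged element \<open>l\<close>: otherwise
      the pulled-back set is one of those excluded by \<open>N\<close>.\<close>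
    have LL: "\<exists>q\<in>S. F ({l, l'} \<union> (S - {q}))" if l: "l \<in> L" "l' \<in> L" "l \<noteq> l'" for l l'
    proof -
      obtain p q where pq: "p \<in> L" "q \<in> S" "p \<noteq> l'" "F (id(l' := l) -` insert p (S - {q}))"
        using merge[of l l'] l L_S(1) by auto
      have "l \<notin> S" "l' \<notin> S" "p \<notin> S" using l pq(1) L_not_S by blast+
      have "id(l' := l) -` insert p (S - {q}) =
          (if p = l then {l, l'} \<union> (S - {q}) else insert p (S - {q}))"
        using l pq(1-3) \<open>l \<notin> S\<close> \<open>l' \<notin> S\<close> \<open>p \<notin> S\<close> by (auto split: if_splits)
      then show ?thesis using pq N[of p q] by (auto split: if_splits)
    qed
    \<comment> \<open>Dually, \<open>q\<close> must be the merged element \<open>s\<close>, and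
      pulling back then removes both \<open>s\<close> and \<open>s'\<close>.\<close>
    have SS: "\<exists>p\<in>L. F (insert p (S - {s, s'}))" if s: "s \<in> S" "s' \<in> S" "s \<noteq> s'" for s s'
    proof -
      obtain p q where pq: "p \<in> L" "q \<in> S" "q \<noteq> s'" "F (id(s' := s) -` insert p (S - {q}))"
        using merge[of s s'] s by (auto simp: V_iff dest: L_not_S)
      have "s \<noteq> p" "s' \<noteq> p" using s pq(1) L_not_S by blast+
      have "id(s' := s) -` insert p (S - {q}) =
          (if q = s then insert p (S - {s, s'}) else insert p (S - {q}))"
        using s pq(1-3) \<open>s \<noteq> p\<close> \<open>s' \<noteq> p\<close> by (auto split: if_splits)
      then show ?thesis using pq N[of p q] by (auto split: if_splits)
    qed

    \<comment> \<open>The element \<open>p\<close> from \<open>SS\<close> depends on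
      \<open>s\<close> and \<open>s'\<close>. Swapping \<open>C\<close> and \<open>C'\<close> in
      \<open>exchange\<close> shows that the families \<open>G l\<close> form a chain, so an
      \<open>i\<close> with the greatest family serves all pairs at once.\<close>
    define G where "G l = {C. C \<subseteq> S \<and> F (insert l C)}" for l
    have "G l \<subseteq> G l' \<or> G l' \<subseteq> G l" if "l \<in> L" "l' \<in> L" for l l'
    proof (rule ccontr)
      assume "\<not> ?thesis"
      then obtain C C' where C: "C \<subseteq> S" "C' \<subseteq> S" "F (insert l C)" "\<not> F (insert l' C)"
        "F (insert l' C')" "\<not> F (insert l C')"
        by (auto simp: G_def)
      have "l \<noteq> l'" "l \<notin> C \<union> C'" "l' \<notin> C \<union> C'"
        using C that L_not_S by blast+
      then have "of_bool (v \<in> insert l C) + of_bool (v \<in> insert l' C') =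
          (of_bool (v \<in> insert l' C) + of_bool (v \<in> insert l C') :: nat)" for v
        by (cases "v = l"; cases "v = l'") simp_all
      then show False
        using exchange[OF C(3,5)] C(4,6) by blast
    qed
    then obtain i where i: "i \<in> L" "\<And>l. l \<in> L \<Longrightarrow> G l \<subseteq> G i"
      using chain_greatest[of L G] L_S(3) \<open>L \<noteq> {}\<close> by blast
    have I: "F (insert i (S - {s, s'}))" if s: "s \<in> S" "s' \<in> S" "s \<noteq> s'" for s s'
    proof -
      obtain p where "p \<in> L" "S - {s, s'} \<in> G p" using SS[OF s] by (auto simp: G_def)
      then have "S - {s, s'} \<in> G i" using i(2) by blast
      then show ?thesis by (simp add: G_def)
    qed

    \<comment> \<open>The same argument for \<open>LL\<close>: a single \<open>q\<close> serves all
      pairs in \<open>L\<close>.\<close>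
    define H where "H q = {A. A \<subseteq> L \<and> F (A \<union> (S - {q}))}" for q
    have "H q \<subseteq> H q' \<or> H q' \<subseteq> H q" if "q \<in> S" "q' \<in> S" for q q'
    proof (rule ccontr)
      assume "\<not> ?thesis"
      then obtain A A' where A: "A \<subseteq> L" "A' \<subseteq> L" "F (A \<union> (S - {q}))" "\<not> F (A \<union> (S - {q'}))"
        "F (A' \<union> (S - {q'}))" "\<not> F (A' \<union> (S - {q}))"
        by (auto simp: H_def)
      have disj: "v \<in> S \<Longrightarrow> v \<notin> A \<and> v \<notin> A'" for v
        using A(1,2) L_not_S by blast
      have "of_bool (v \<in> A \<union> (S - {q})) + of_bool (v \<in> A' \<union> (S - {q'})) =
          (of_bool (v \<in> A \<union> (S - {q'})) + of_bool (v \<in> A' \<union> (S - {q})) :: nat)" for v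
        using disj[of v] by (cases "v \<in> S") simp_all
      then show False
        using exchange[OF A(3,5)] A(4,6) by blast
    qed
    then obtain q where q: "q \<in> S" "\<And>s. s \<in> S \<Longrightarrow> H s \<subseteq> H q"
      using chain_greatest[of S H] L_S(4) \<open>S \<noteq> {}\<close> by blast
    have Q: "F ({l, l'} \<union> (S - {q}))" if l: "l \<in> L" "l' \<in> L" "l \<noteq> l'" for l l'
    proof -
      obtain s where "s \<in> S" "{l, l'} \<in> H s" using LL[OF l] l by (auto simp: H_def)
      then have "{l, l'} \<in> H q" using q(2) by blast
      then show ?thesis by (simp add: H_def)
    qed

    obtain l where l: "l \<in> L" "l \<noteq> i" using l0 l1 by metis
    obtain r where r: "r \<in> S" "r \<noteq> q" using s0 s1 by metis
    \<comment> \<open>The cases record whether \<open>L\<close> and \<open>S\<close> have a third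
      element.\<close>
    consider "L = {i, l}" "S = {q, r}"
      | l' where "l' \<in> L" "l' \<noteq> i" "l' \<noteq> l" "S = {q, r}"
      | r' where "L = {i, l}" "r' \<in> S" "r' \<noteq> q" "r' \<noteq> r"
      | l' r' where "l' \<in> L" "l' \<noteq> i" "l' \<noteq> l" "r' \<in> S" "r' \<noteq> q" "r' \<noteq> r"
      using i(1) l q(1) r by blast
    then show False
    proof cases
      case 1
      \<comment> \<open>\<open>V\<close> splits into two disjoint sets that are small by
        \<open>N\<close>, although \<open>V\<close> is large.\<close>
      have "S - {r} = {q}" "S - {q} = {r}" using 1 r by auto
      then have "\<not> F {i, q}" "\<not> F {l, r}" using N[OF i(1) r(1)] N[OF l(1) q(1)] by auto
      moreover have "{i, q} \<inter> {l, r} = {}" using 1 l r by (auto dest: L_not_S)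
      ultimately have "\<not> F ({i, q} \<union> {l, r})" using disjoint_union by blast
      moreover have "{i, q} \<union> {l, r} = V" using 1 L_S(1) by auto
      ultimately show False using large_V by simp
    next
      case (2 l')
      \<comment> \<open>Adding one of \<open>i, l, l'\<close> to \<open>P\<close> gives the
        complement of a set that is large by \<open>Q\<close>; adding it to \<open>{r}\<close> gives
        a set that is small by \<open>N\<close>. All six sets are thus small.\<close>
      define P where "P = insert q (L - {i, l, l'})"
      have Ssub: "S \<subseteq> {q, r}" using 2(4) by (rule equalityD1)
      then have Sr: "S - {r} = {q}" "S - {q} = {r}" using r q(1) by blast+
      have notin: "r \<notin> L" "q \<notin> L" using r q(1) L_not_S by blast+
      have nr: "\<not> F {a, r}" if "a \<in> L" for a using N[OF that q(1)] Sr by simp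
      have nq: "\<not> F (insert q (L - {b, c}))" if "b \<in> L" "c \<in> L" "b \<noteq> c" for b c
      proof -
        have "F ({b, c} \<union> {r})" using Q[OF that] unfolding Sr(2) .
        then have "F {b, c, r}" by (simp only: Un_insert_left Un_empty_left)
        moreover have "F {b, c, r} \<longleftrightarrow> \<not> F (insert q (L - {b, c}))"
        proof (rule large_iff_small)
          show "{b, c, r} \<inter> insert q (L - {b, c}) = {}"
            using that r(2) notin by blast
          show "V \<subseteq> {b, c, r} \<union> insert q (L - {b, c})"
            using V_iff Ssub by blast
        qed
        ultimately show ?thesis by simp
      qed
      have eqs: "insert i P = insert q (L - {l, l'})" "insert l P = insert q (L - {i, l'})"
        "insert l' P = insert q (L - {i, l})"
        using 2(1-3) i(1) l unfolding P_def by blast+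
      have "\<not> F (insert i P)" "\<not> F (insert l P)" "\<not> F (insert l' P)"
        unfolding eqs by (rule nq; use 2(1-3) i(1) l in simp)+
      then have "\<forall>x\<in>{i, l, l'}. \<not> F (insert x P) \<and> \<not> F (insert x {r})"
        using nr[OF i(1)] nr[OF l(1)] nr[OF 2(1)] by blast
      moreover have "\<exists>x\<in>{i, l, l'}. F (insert x P) \<noteq> False \<or> F (insert x {r}) \<noteq> False"
      proof (rule partition_not_constant)
        show "distinct [i, l, l']" using 2(2,3) l(2) by simp
        show "{i, l, l'} \<inter> (P \<union> {r}) = {}" "P \<inter> {r} = {}"
          using 2(1) i(1) l(1) r(2) notin unfolding P_def by blast+
        show "V \<subseteq> P \<union> {r} \<union> {i, l, l'}"
          using V_iff Ssub unfolding P_def by blast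
      qed
      ultimately show False by blast
    next
      case (3 r')
      \<comment> \<open>The dual situation: adding one of \<open>q, r, r'\<close> to
        \<open>P\<close> gives a large set by \<open>I\<close>, and adding it to \<open>{l}\<close>
        gives the complement of a set that is small by \<open>N\<close>.\<close>
      define P where "P = insert i (S - {q, r, r'})"
      have Lsub: "L \<subseteq> {i, l}" using 3(1) by (rule equalityD1)
      have notin: "i \<notin> S" "l \<notin> S" using i(1) l(1) L_not_S by blast+
      have lr: "F {a, l}" if "a \<in> S" for a
      proof -
        have "F (insert i (S - {a})) \<longleftrightarrow> \<not> F {a, l}"
        proof (rule large_iff_small)
          show "insert i (S - {a}) \<inter> {a, l} = {}"
            using that l(2) notin by blast
          show "V \<subseteq> insert i (S - {a}) \<union> {a, l}"
            using V_iff Lsub by blast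
        qed
        then show ?thesis using N[OF i(1) that] by simp
      qed
      have eqs: "insert q P = insert i (S - {r, r'})" "insert r P = insert i (S - {q, r'})"
        "insert r' P = insert i (S - {q, r})"
        using 3(2-4) q(1) r unfolding P_def by blast+
      have "F (insert q P)" "F (insert r P)" "F (insert r' P)"
        unfolding eqs by (rule I; use 3(2-4) q(1) r in simp)+
      then have "\<forall>x\<in>{q, r, r'}. F (insert x P) \<and> F (insert x {l})"
        using lr[OF q(1)] lr[OF r(1)] lr[OF 3(2)] by blast
      moreover have "\<exists>x\<in>{q, r, r'}. F (insert x P) \<noteq> True \<or> F (insert x {l}) \<noteq> True"
      proof (rule partition_not_constant)
        show "distinct [q, r, r']" using 3(3,4) r(2) by simp
        show "{q, r, r'} \<inter> (P \<union> {l}) = {}" "P \<inter> {l} = {}"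
          using 3(2) q(1) r(1) l(2) notin unfolding P_def by blast+
        show "V \<subseteq> P \<union> {l} \<union> {q, r, r'}"
          using V_iff Lsub unfolding P_def by blast
      qed
      ultimately show False by blast
    next
      case (4 l' r')
      \<comment> \<open>This set contains \<open>l\<close> and \<open>l'\<close>, and its part in
        \<open>S\<close> avoids \<open>q\<close>, so it is large by \<open>Q\<close>. Its complement
        in \<open>V\<close> is large by \<open>I\<close>.\<close>
      have "F ((L - {i}) \<union> {r, r'})"
        by (rule large_mono[OF Q[of l l']]) (use 4 l r i(1) in \<open>auto dest: L_not_S\<close>)
      moreover have "F (insert i (S - {r, r'}))" using I[of r r'] 4 r by auto
      moreover have "F (insert i (S - {r, r'})) \<longleftrightarrow> \<not> F ((L - {i}) \<union> {r, r'})"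
        using i(1) r 4 by (intro large_iff_small) (auto simp: V_iff dest: L_not_S)
      ultimately show False by simp
    qed
  qed
qed

section \<open>From large sets back to polymorphisms\<close>

lemma Pol_large_sets:
  assumes "(n, f) \<in> Pol ST_L ST_R" "idempotent (n, f)"
  shows "large_sets {..<n} (\<lambda>X. f (map (\<lambda>i. i \<in> X) [0..<n]))"
proof -
  let ?t = "\<lambda>X. map (\<lambda>i. i \<in> X) [0..<n]"
  \<comment> \<open>The rows are characteristic tuples of the sets in \<open>Xs\<close>, so column
    \<open>i\<close> lists the memberships of \<open>i\<close>.\<close>
  have pol: "map (\<lambda>X. f (?t X)) Xs \<in> NAE k"
    if "(k, R) \<in> {(6, ST_rel), (4, two_in_four)}" "length Xs = k"
      "\<And>i. i < n \<Longrightarrow> map (\<lambda>X. i \<in> X) Xs \<in> R" for k R Xs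
  proof -
    have "map ?t Xs \<in> nlists k (nlists n UNIV)"
      using that(2) by (auto intro!: nlistsI)
    moreover have "map (\<lambda>x. x ! i) (map ?t Xs) \<in> R" if "i < n" for i
      using that \<open>\<And>i. i < n \<Longrightarrow> map (\<lambda>X. i \<in> X) Xs \<in> R\<close>[OF that] by (simp add: comp_def)
    ultimately have "map f (map ?t Xs) \<in> NAE k"
      using assms(1) that(1) unfolding Pol_ST_iff by blast
    then show ?thesis by (simp add: comp_def)
  qed
  show ?thesis
  proof
    show "f (?t X) = f (?t Y)" if XY: "X \<inter> {..<n} = Y \<inter> {..<n}" for X Y
    proof -
      have "i \<in> X \<longleftrightarrow> i \<in> Y" if "i < n" for i
        using XY that by blast
      then have "?t X = ?t Y" by (intro map_cong) simp_all
      then show ?thesis by (rule arg_cong)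
    qed
    have "?t {} = replicate n False" "?t {..<n} = replicate n True"
      by (auto intro: nth_equalityI)
    then show "\<not> f (?t {})" "f (?t {..<n})"
      using assms(2) by (simp_all only: idempotent.simps not_False_eq_True)
  next
    fix X1 X2 X3 X4 b
    assume "\<forall>v\<in>{..<n}. [v \<in> X1, v \<in> X2, v \<in> X3, v \<in> X4] \<in> two_in_four"
    then show "\<not> (\<forall>X\<in>{X1, X2, X3, X4}. f (?t X) = b)"
      using pol[of 4 two_in_four "[X1, X2, X3, X4]"] by (auto simp: NAE_def eval_nat_numeral)
  next
    fix X1 X2 X3 X4 X5 X6 b
    assume "\<forall>v\<in>{..<n}. [v \<in> X1, v \<in> X2, v \<in> X3, v \<in> X4, v \<in> X5, v \<in> X6] \<in> ST_rel"
    then show "\<not> (\<forall>X\<in>{X1, X2, X3, X4, X5, X6}. f (?t X) = b)"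
      using pol[of 6 ST_rel "[X1, X2, X3, X4, X5, X6]"] by (auto simp: NAE_def eval_nat_numeral)
  qed simp
qed

lemma Pol_minor_fixing_pair:
  assumes "(n, f) \<in> Pol ST_L ST_R" "idempotent (n, f)"
    and "minor_of UNIV UNIV (m, g) (n, f)" "m \<ge> 2"
  shows "\<exists>i j. fixing_pair (m, g) i j"
proof -
  let ?F = "\<lambda>X. f (map (\<lambda>i. i \<in> X) [0..<n])"
  obtain \<pi> where \<pi>: "\<pi> \<in> {..<n} \<rightarrow> {..<m}"
    "\<And>a. length a = m \<Longrightarrow> g a = f (map (\<lambda>i. a ! \<pi> i) [0..<n])"
    using assms(3) by (auto simp: nlists_UNIV_iff)
  have G: "large_sets {..<m} (\<lambda>X. ?F (\<pi> -` X))"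
    using Pol_large_sets[OF assms(1,2)] \<pi>(1) by (rule large_sets_vimage) simp
  then obtain i j where ij: "i < m" "j < m" "i \<noteq> j"
    and fp: "\<And>X. i \<in> X \<Longrightarrow> j \<notin> X \<Longrightarrow> ?F (\<pi> -` X)"
    using large_sets_fixing_pair[OF G] assms(4) by auto
  have g: "g a = ?F (\<pi> -` {v. a ! v})" if "length a = m" for a
    using that by (simp add: \<pi>(2))
  have "g a" if "length a = m" "a ! i" "\<not> a ! j" for a
    using fp[of "{v. a ! v}"] g that by simp
  \<comment> \<open>The complement of the set of ones of \<open>a\<close> contains \<open>i\<close>
    and avoids \<open>j\<close>, hence is large.\<close>
  moreover have "\<not> g a" if "length a = m" "\<not> a ! i" "a ! j" for a
    using fp[of "- {v. a ! v}"] g that large_sets.compl[OF G, of "{v. a ! v}"] by simp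
  ultimately show ?thesis
    using ij by (intro exI[of _ i] exI[of _ j]) (auto simp: nlists_UNIV_iff)
qed

theorem theorem3p8:
  fixes n :: nat and f :: "bool list \<Rightarrow> bool"
  assumes "n \<ge> 1" and "f \<in> nlists n UNIV \<rightarrow>\<^sub>E UNIV"
  shows "((n, f) \<in> ST \<longleftrightarrow>
            (n, f) \<in> Pol ST_L ST_R \<inter> Pol_singleton False \<inter> Pol_singleton True) \<and>
         ((n, f) \<in> Pol ST_L ST_R \<inter> Pol_singleton False \<inter> Pol_singleton True \<longleftrightarrow>
            idempotent (n, f) \<and>
            (\<forall>m g. minor_of UNIV UNIV (m, g) (n, f) \<and> m \<ge> 2 \<longrightarrow> (\<exists>i j. fixing_pair (m, g) i j)))"
proof -
  have fin: "(n, f) \<in> finfuns UNIV UNIV"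
    using assms by (simp add: finfuns_def)
  have idem: "(n, f) \<in> Pol_singleton False \<inter> Pol_singleton True \<longleftrightarrow> idempotent (n, f)"
    using fin by (auto simp: Pol_singleton_iff all_bool_eq)
  show ?thesis
    \<comment> \<open>The implications close a cycle: decision lists are idempotent polymorphisms,
      these have fixing pairs in all non-unary minors, and that condition with idempotence gives a
      decision list again.\<close>
    using ST_iff[OF fin] is_stair_Pol[OF fin] is_stair_idempotent[of n f]
      Pol_minor_fixing_pair[of n f] fixing_pairs_is_stair[OF fin] idem
    by blast
qed

end
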